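(* Let $L\in\mathcal L$ be a lower real and let $U=\{q\in\mathbb Q\mid\exists_{s\in\mathbb Q\setminus L}\,s<q\}$. Then $L$ is a sharp element of the continuous dcpo $\mathcal L$ if and only if the pair $(L,U)$ is located, i.e. for every $p,q\in\mathbb Q$ with $p<q$ we have $p\in L$ or $q\in U$.
   Context: Everything is constructive: neither excluded middle nor choice is assumed. A subset $S$ of a poset is directed if it is inhabited and any two elements of $S$ have an upper bound in $S$. A dcpo is a poset $(D,\sqsubseteq)$ in which every directed subset $S$ has a supremum $\bigsqcup S$. Write $x\ll y$ if for every directed $S$ with $y\sqsubseteq\bigsqcup S$ there is $s\in S$ with $x\sqsubseteq s$. $D$ is continuous if for every $x$ the set $\{y\in D\mid y\ll x\}$ is directed with supremum $x$. An element $x\in D$ is sharp if for every $y,z\in D$ with $y\ll z$ we have $y\ll x$ or $\lnot(z\sqsubseteq x)$. $\mathcal L$ is the rounded ideal completion of $(\mathbb Q,<)$: its elements (lower reals) are the subsets $L\subseteq\mathbb Q$ that are lower sets with respect to $<$ and directed with respect to $<$ (inhabited, and for all $p,q\in L$ there is $r\in L$ with $p<r$ and $q<r$), ordered by inclusion, with directed suprema given by unions. It is a continuous dcpo. *)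

theory Defs
  imports Complex_Main
begin

text \<open>
  The mathematics formalised here is constructive, and in the classical metalogic HOL it would
  collapse: read with truth values in \<^typ>\<open>bool\<close>, every element of a dcpo is sharp and every lower
  real is located, by excluded middle. Propositions are therefore interpreted in an arbitrary
  complete Heyting algebra \<open>'h\<close> (the standard Heyting-valued semantics of intuitionistic
  higher-order logic): a subset of \<open>'a\<close> is a function \<open>'a \<Rightarrow> 'h\<close>, a family of subsets is a function
  \<open>('a \<Rightarrow> 'h) \<Rightarrow> 'h\<close>, conjunction and disjunction are \<open>\<sqinter>\<close> and \<open>\<squnion>\<close>, the quantifiers \<open>\<forall>\<close> and \<open>\<exists>\<close> are
  \<open>\<Sqinter>\<close> and \<open>\<Squnion>\<close>, and a statement is asserted by saying that its value is \<open>\<top>\<close>. Neither excluded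
  middle nor choice is valid in this semantics for general \<open>'h\<close>; for \<open>'h = bool\<close> every definition
  below is the usual one.
\<close>

unbundle lattice_syntax

subsection \<open>Heyting-valued logic\<close>

text \<open>The library class \<^class>\<open>complete_distrib_lattice\<close> demands complete distributivity, which
  fails for most complete Heyting algebras (for instance for the open sets of the real line).\<close>

class complete_heyting_algebra = complete_lattice +
  assumes inf_Sup_le: "inf a (Sup B) \<le> Sup (inf a ` B)"

instance bool :: complete_heyting_algebra
  by standard auto

definition himp :: "'h \<Rightarrow> 'h \<Rightarrow> 'h::complete_heyting_algebra"  (infixr \<open>\<rightarrow>\<^sub>H\<close> 60)
  where "a \<rightarrow>\<^sub>H b = \<Squnion>{c. a \<sqinter> c \<le> b}"

definition hiff :: "'h \<Rightarrow> 'h \<Rightarrow> 'h::complete_heyting_algebra"  (infix \<open>\<leftrightarrow>\<^sub>H\<close> 55)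
  where "(a \<leftrightarrow>\<^sub>H b) = (a \<rightarrow>\<^sub>H b) \<sqinter> (b \<rightarrow>\<^sub>H a)"

definition hnot :: "'h \<Rightarrow> 'h::complete_heyting_algebra"  (\<open>\<not>\<^sub>H _\<close> [75] 75)
  where "\<not>\<^sub>H a = (a \<rightarrow>\<^sub>H \<bottom>)"

text \<open>Only used for the order of the rationals, which is constructively decidable: the object of
  rationals of a Heyting-valued model is the constant one, with two-valued equality and order.\<close>

definition tv :: "bool \<Rightarrow> 'h::complete_heyting_algebra"
  where "tv P = (if P then \<top> else \<bottom>)"

definition valid :: "'h::complete_heyting_algebra \<Rightarrow> bool"  (\<open>\<turnstile>\<^sub>H _\<close> [5] 5)
  where "(\<turnstile>\<^sub>H a) \<longleftrightarrow> a = \<top>"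

subsection \<open>Posets, dcpos and sharp elements, internally\<close>

text \<open>A set with order: membership, equality and order are all \<open>'h\<close>-valued.\<close>

record ('a, 'h) hposet =
  hmem :: "'a \<Rightarrow> 'h"
  heq :: "'a \<Rightarrow> 'a \<Rightarrow> 'h"
  hle :: "'a \<Rightarrow> 'a \<Rightarrow> 'h"

definition is_hposet :: "('a, 'h::complete_heyting_algebra) hposet \<Rightarrow> 'h" where
  "is_hposet D =
     (\<Sqinter>x y. hmem D x \<sqinter> heq D x y \<rightarrow>\<^sub>H hmem D y) \<sqinter>
     (\<Sqinter>x y. hmem D x \<sqinter> hmem D y \<sqinter> heq D x y \<rightarrow>\<^sub>H hle D x y \<sqinter> hle D y x) \<sqinter>
     (\<Sqinter>x. hmem D x \<rightarrow>\<^sub>H hle D x x) \<sqinter>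
     (\<Sqinter>x y z. hmem D x \<sqinter> hmem D y \<sqinter> hmem D z \<sqinter> hle D x y \<sqinter> hle D y z \<rightarrow>\<^sub>H hle D x z) \<sqinter>
     (\<Sqinter>x y. hmem D x \<sqinter> hmem D y \<sqinter> hle D x y \<sqinter> hle D y x \<rightarrow>\<^sub>H heq D x y)"

text \<open>The second conjunct says that membership in \<open>S\<close> respects the equality of \<open>D\<close>, without which
  a function \<open>'a \<Rightarrow> 'h\<close> does not denote a subset.\<close>

definition hsubset :: "('a, 'h::complete_heyting_algebra) hposet \<Rightarrow> ('a \<Rightarrow> 'h) \<Rightarrow> 'h" where
  "hsubset D S =
     (\<Sqinter>x. S x \<rightarrow>\<^sub>H hmem D x) \<sqinter>
     (\<Sqinter>x y. S x \<sqinter> hmem D y \<sqinter> heq D x y \<rightarrow>\<^sub>H S y)"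

definition hdirected :: "('a \<Rightarrow> 'a \<Rightarrow> 'h::complete_heyting_algebra) \<Rightarrow> ('a \<Rightarrow> 'h) \<Rightarrow> 'h" where
  "hdirected R S =
     (\<Squnion>x. S x) \<sqinter>
     (\<Sqinter>x y. S x \<sqinter> S y \<rightarrow>\<^sub>H (\<Squnion>z. S z \<sqinter> R x z \<sqinter> R y z))"

definition his_sup ::
  "('a, 'h::complete_heyting_algebra) hposet \<Rightarrow> ('a \<Rightarrow> 'h) \<Rightarrow> 'a \<Rightarrow> 'h" where
  "his_sup D S u =
     hmem D u \<sqinter>
     (\<Sqinter>s. S s \<rightarrow>\<^sub>H hle D s u) \<sqinter>
     (\<Sqinter>v. hmem D v \<sqinter> (\<Sqinter>s. S s \<rightarrow>\<^sub>H hle D s v) \<rightarrow>\<^sub>H hle D u v)"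

definition hdcpo :: "('a, 'h::complete_heyting_algebra) hposet \<Rightarrow> 'h" where
  "hdcpo D =
     is_hposet D \<sqinter>
     (\<Sqinter>S. hsubset D S \<sqinter> hdirected (hle D) S \<rightarrow>\<^sub>H (\<Squnion>u. his_sup D S u))"

text \<open>In the way-below relation the condition that \<open>y\<close> lies below the supremum of \<open>S\<close> is expressed
  through an element \<open>u\<close> that is a supremum of \<open>S\<close>; it exists in a dcpo and is unique.\<close>

definition hwaybelow ::
  "('a, 'h::complete_heyting_algebra) hposet \<Rightarrow> 'a \<Rightarrow> 'a \<Rightarrow> 'h" where
  "hwaybelow D x y =
     (\<Sqinter>S. hsubset D S \<sqinter> hdirected (hle D) S \<rightarrow>\<^sub>H
        (\<Squnion>u. his_sup D S u \<sqinter> hle D y u) \<rightarrow>\<^sub>H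
        (\<Squnion>s. S s \<sqinter> hle D x s))"

definition hcontinuous :: "('a, 'h::complete_heyting_algebra) hposet \<Rightarrow> 'h" where
  "hcontinuous D =
     (\<Sqinter>x. hmem D x \<rightarrow>\<^sub>H
        hdirected (hle D) (\<lambda>y. hmem D y \<sqinter> hwaybelow D y x) \<sqinter>
        his_sup D (\<lambda>y. hmem D y \<sqinter> hwaybelow D y x) x)"

definition hsharp :: "('a, 'h::complete_heyting_algebra) hposet \<Rightarrow> 'a \<Rightarrow> 'h" where
  "hsharp D x =
     (\<Sqinter>y z. hmem D y \<sqinter> hmem D z \<rightarrow>\<^sub>H
        hwaybelow D y z \<rightarrow>\<^sub>H
        hwaybelow D y x \<squnion> \<not>\<^sub>H hle D z x)"

subsection \<open>Lower reals\<close>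

definition hlower_real :: "(rat \<Rightarrow> 'h::complete_heyting_algebra) \<Rightarrow> 'h" where
  "hlower_real L =
     (\<Sqinter>p q. tv (p < q) \<sqinter> L q \<rightarrow>\<^sub>H L p) \<sqinter>
     hdirected (\<lambda>p q. tv (p < q)) L"

definition lower_reals :: "(rat \<Rightarrow> 'h, 'h::complete_heyting_algebra) hposet"  (\<open>\<L>\<close>) where
  "\<L> = \<lparr> hmem = hlower_real,
         heq = (\<lambda>L M. \<Sqinter>q. L q \<leftrightarrow>\<^sub>H M q),
         hle = (\<lambda>L M. \<Sqinter>q. L q \<rightarrow>\<^sub>H M q) \<rparr>"

definition upper_cut :: "(rat \<Rightarrow> 'h::complete_heyting_algebra) \<Rightarrow> rat \<Rightarrow> 'h" where
  "upper_cut L q = (\<Squnion>s. \<not>\<^sub>H L s \<sqinter> tv (s < q))"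

definition hlocated ::
  "(rat \<Rightarrow> 'h::complete_heyting_algebra) \<Rightarrow> (rat \<Rightarrow> 'h) \<Rightarrow> 'h" where
  "hlocated L U = (\<Sqinter>p q. tv (p < q) \<rightarrow>\<^sub>H L p \<squnion> U q)"

subsection \<open>Truth in a complete Heyting algebra\<close>

lemma himp_adjoint: "c \<le> (a \<rightarrow>\<^sub>H b) \<longleftrightarrow> a \<sqinter> c \<le> b"
proof
  assume "c \<le> (a \<rightarrow>\<^sub>H b)"
  then have "a \<sqinter> c \<le> a \<sqinter> \<Squnion>{c. a \<sqinter> c \<le> b}"
    unfolding himp_def by (rule inf_mono[OF order_refl])
  also have "\<dots> \<le> \<Squnion>(inf a ` {c. a \<sqinter> c \<le> b})" by (rule inf_Sup_le)
  also have "\<dots> \<le> b" by (rule Sup_least) auto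
  finally show "a \<sqinter> c \<le> b" .
qed (auto simp: himp_def intro: Sup_upper)

lemma le_himp_iff: "c \<le> (a \<rightarrow>\<^sub>H b) \<longleftrightarrow> (\<forall>d \<le> c. d \<le> a \<longrightarrow> d \<le> b)"
  unfolding himp_adjoint
  by (meson inf.bounded_iff inf.cobounded1 inf.cobounded2 order_refl order_trans)

lemma le_tv_iff: "c \<le> tv P \<longleftrightarrow> P \<or> c = \<bottom>"
  by (auto simp: tv_def bot_unique)

lemma le_hnot_iff: "c \<le> \<not>\<^sub>H a \<longleftrightarrow> (\<forall>d \<le> c. d \<le> a \<longrightarrow> d = \<bottom>)"
  by (simp add: hnot_def le_himp_iff bot_unique)

lemma le_hiff_iff: "c \<le> (a \<leftrightarrow>\<^sub>H b) \<longleftrightarrow> (\<forall>d \<le> c. d \<le> a \<longleftrightarrow> d \<le> b)"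
  by (auto simp: hiff_def le_himp_iff)

lemma le_SUP_elim:
  fixes b c :: "'h::complete_heyting_algebra"
  assumes "c \<le> (\<Squnion>i. f i)" and "\<And>i d. d \<le> c \<Longrightarrow> d \<le> f i \<Longrightarrow> d \<le> b"
  shows "c \<le> b"
proof -
  have "c \<le> c \<sqinter> \<Squnion>(range f)" using assms(1) by simp
  also have "\<dots> \<le> \<Squnion>(inf c ` range f)" by (rule inf_Sup_le)
  also have "\<dots> \<le> b"
    by (rule Sup_least) (auto intro!: assms(2) inf.cobounded1 inf.cobounded2)
  finally show ?thesis .
qed

lemma le_sup_elim:
  fixes b c :: "'h::complete_heyting_algebra"
  assumes "c \<le> x \<squnion> y" and "\<And>d. d \<le> c \<Longrightarrow> d \<le> x \<Longrightarrow> d \<le> b" and "\<And>d. d \<le> c \<Longrightarrow> d \<le> y \<Longrightarrow> d \<le> b"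
  shows "c \<le> b"
proof (rule le_SUP_elim)
  show "c \<le> (\<Squnion>i. if i then x else y)"
    using assms(1) by (simp add: UNIV_bool sup.commute)
qed (auto split: if_splits intro: assms(2,3))

lemma valid_iff: "(\<turnstile>\<^sub>H a) \<longleftrightarrow> (\<forall>c. c \<le> a)"
  unfolding valid_def by (metis top_greatest top_unique)

subsection \<open>The lower reals form a continuous dcpo\<close>

lemma lower_reals_sel:
  "hmem \<L> = hlower_real" "heq \<L> L M = (\<Sqinter>q. L q \<leftrightarrow>\<^sub>H M q)" "hle \<L> L M = (\<Sqinter>q. L q \<rightarrow>\<^sub>H M q)"
  by (simp_all add: lower_reals_def)

lemma le_hle_iff: "c \<le> hle \<L> L M \<longleftrightarrow> (\<forall>q. \<forall>d\<le>c. d \<le> L q \<longrightarrow> d \<le> M q)"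
  by (simp add: lower_reals_sel le_INF_iff le_himp_iff)

lemma le_heq_iff: "c \<le> heq \<L> L M \<longleftrightarrow> (\<forall>q. \<forall>d\<le>c. d \<le> L q \<longleftrightarrow> d \<le> M q)"
  by (simp add: lower_reals_sel le_INF_iff le_hiff_iff)

lemma le_heq_hle: "c \<le> heq \<L> L M \<longleftrightarrow> c \<le> hle \<L> L M \<and> c \<le> hle \<L> M L"
  unfolding le_heq_iff le_hle_iff by fast

lemma lower_real_down: "c \<le> hlower_real L \<Longrightarrow> p < q \<Longrightarrow> c \<le> L q \<Longrightarrow> c \<le> L p"
  unfolding hlower_real_def by (simp add: le_INF_iff le_himp_iff le_tv_iff) blast

lemma lower_real_inhabited: "c \<le> hlower_real L \<Longrightarrow> c \<le> (\<Squnion>p. L p)"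
  by (simp add: hlower_real_def hdirected_def)

lemma le_hdirected_iff:
  "c \<le> hdirected R S \<longleftrightarrow> c \<le> (\<Squnion>x. S x) \<and>
     (\<forall>x y. \<forall>d\<le>c. d \<le> S x \<longrightarrow> d \<le> S y \<longrightarrow> d \<le> (\<Squnion>z. S z \<sqinter> R x z \<sqinter> R y z))"
  by (simp add: hdirected_def le_INF_iff le_himp_iff imp_conjL)

lemma lower_real_round:
  assumes "c \<le> hlower_real L" "c \<le> L p"
  shows "c \<le> (\<Squnion>r. L r \<sqinter> tv (p < r))"
proof -
  have "c \<le> hdirected (\<lambda>p q. tv (p < q)) L" using assms(1) by (simp add: hlower_real_def)
  then have "c \<le> (\<Squnion>r. L r \<sqinter> tv (p < r) \<sqinter> tv (p < r))"
    using assms(2) unfolding le_hdirected_iff by blast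
  then show ?thesis by (simp add: inf.assoc)
qed

lemma lower_realI:
  assumes "\<And>p q d. p < q \<Longrightarrow> d \<le> c \<Longrightarrow> d \<le> L q \<Longrightarrow> d \<le> L p"
    and "c \<le> (\<Squnion>p. L p)"
    and "\<And>p d. d \<le> c \<Longrightarrow> d \<le> L p \<Longrightarrow> d \<le> (\<Squnion>r. L r \<sqinter> tv (p < r))"
  shows "c \<le> hlower_real L"
proof -
  have "d \<le> (\<Squnion>z. L z \<sqinter> tv (p < z) \<sqinter> tv (q < z))" if "d \<le> c" "d \<le> L p" "d \<le> L q" for p q d
  proof -
    have "d \<le> L (max p q)" using that by (simp add: max_def)
    from assms(3)[OF that(1) this] show ?thesis
    proof (rule le_SUP_elim)
      fix r e assume "e \<le> d" "e \<le> L r \<sqinter> tv (max p q < r)"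
      then show "e \<le> (\<Squnion>z. L z \<sqinter> tv (p < z) \<sqinter> tv (q < z))"
        by (intro SUP_upper2[of r]) (auto simp: le_tv_iff)
    qed
  qed
  moreover have "d \<le> L p" if "d \<le> c" "d \<le> tv (p < q)" "d \<le> L q" for p q d
    using that assms(1)[of p q d] by (auto simp: le_tv_iff)
  ultimately show ?thesis using assms(2)
    by (auto simp: hlower_real_def hdirected_def le_INF_iff le_himp_iff)
qed

lemma le_hsubset_iff:
  "c \<le> hsubset D S \<longleftrightarrow> (\<forall>x. \<forall>d\<le>c. d \<le> S x \<longrightarrow> d \<le> hmem D x) \<and>
     (\<forall>x y. \<forall>d\<le>c. d \<le> S x \<longrightarrow> d \<le> hmem D y \<longrightarrow> d \<le> heq D x y \<longrightarrow> d \<le> S y)"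
  by (simp add: hsubset_def le_INF_iff le_himp_iff imp_conjL)

lemma le_his_sup_iff:
  "c \<le> his_sup D S u \<longleftrightarrow> c \<le> hmem D u \<and> (\<forall>s. \<forall>d\<le>c. d \<le> S s \<longrightarrow> d \<le> hle D s u) \<and>
     (\<forall>v. \<forall>d\<le>c. d \<le> hmem D v \<longrightarrow> (\<forall>s. \<forall>e\<le>d. e \<le> S s \<longrightarrow> e \<le> hle D s v) \<longrightarrow> d \<le> hle D u v)"
  by (simp add: his_sup_def le_INF_iff le_himp_iff imp_conjL)

lemma lower_reals_poset: "\<turnstile>\<^sub>H is_hposet \<L>"
proof -
  have "d \<le> hlower_real M" if "d \<le> hlower_real L" "d \<le> heq \<L> L M" for d :: "'h::complete_heyting_algebra" and L M
  proof (rule lower_realI)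
    have eq: "e \<le> L q \<longleftrightarrow> e \<le> M q" if "e \<le> d" for e q
      using \<open>d \<le> heq \<L> L M\<close> that by (auto simp: le_heq_iff)
    show "e \<le> M p" if "p < q" "e \<le> d" "e \<le> M q" for p q e
      using lower_real_down[of e L p q] \<open>d \<le> hlower_real L\<close> that eq[of e] by auto
    show "d \<le> (\<Squnion>p. M p)"
      using lower_real_inhabited[OF that(1)]
    proof (rule le_SUP_elim)
      fix p e assume "e \<le> d" "e \<le> L p"
      then show "e \<le> (\<Squnion>p. M p)" using eq by (intro SUP_upper2[of p]) auto
    qed
    show "e \<le> (\<Squnion>r. M r \<sqinter> tv (p < r))" if "e \<le> d" "e \<le> M p" for p e
    proof -
      have "e \<le> (\<Squnion>r. L r \<sqinter> tv (p < r))"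
        using that eq[of e p] \<open>d \<le> hlower_real L\<close> by (intro lower_real_round) auto
      then show ?thesis
      proof (rule le_SUP_elim)
        fix r e' assume "e' \<le> e" "e' \<le> L r \<sqinter> tv (p < r)"
        then show "e' \<le> (\<Squnion>r. M r \<sqinter> tv (p < r))"
          using eq[of e' r] \<open>e \<le> d\<close> by (intro SUP_upper2[of r]) auto
      qed
    qed
  qed
  then have "c \<le> (\<Sqinter>L M. hlower_real L \<sqinter> heq \<L> L M \<rightarrow>\<^sub>H hlower_real M)"
    for c :: "'h::complete_heyting_algebra"
    by (auto simp: le_INF_iff le_himp_iff)
  moreover have "c \<le> (\<Sqinter>L M. hlower_real L \<sqinter> hlower_real M \<sqinter> heq \<L> L M \<rightarrow>\<^sub>H hle \<L> L M \<sqinter> hle \<L> M L)"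
    for c :: "'h::complete_heyting_algebra"
    by (simp add: le_INF_iff le_himp_iff le_heq_hle)
  moreover have "c \<le> (\<Sqinter>L. hlower_real L \<rightarrow>\<^sub>H hle \<L> L L)" for c :: "'h::complete_heyting_algebra"
    by (simp add: le_INF_iff le_himp_iff le_hle_iff)
  moreover have "c \<le> (\<Sqinter>L M N. hlower_real L \<sqinter> hlower_real M \<sqinter> hlower_real N \<sqinter> hle \<L> L M \<sqinter> hle \<L> M N
      \<rightarrow>\<^sub>H hle \<L> L N)" for c :: "'h::complete_heyting_algebra"
    by (simp add: le_INF_iff le_himp_iff le_hle_iff)
  moreover have "c \<le> (\<Sqinter>L M. hlower_real L \<sqinter> hlower_real M \<sqinter> hle \<L> L M \<sqinter> hle \<L> M L \<rightarrow>\<^sub>H heq \<L> L M)"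
    for c :: "'h::complete_heyting_algebra"
    by (simp add: le_INF_iff le_himp_iff le_heq_hle)
  ultimately show ?thesis
    unfolding valid_iff is_hposet_def lower_reals_sel(1) by (simp only: le_inf_iff) blast
qed

lemma lower_reals_union:
  fixes S :: "(rat \<Rightarrow> 'h::complete_heyting_algebra) \<Rightarrow> 'h"
  assumes sub: "c \<le> hsubset \<L> S" and dir: "c \<le> hdirected (hle \<L>) S"
  shows "c \<le> his_sup \<L> S (\<lambda>q. \<Squnion>M. S M \<sqinter> M q)"
proof -
  let ?U = "\<lambda>q. \<Squnion>M. S M \<sqinter> M q"
  have low: "d \<le> hlower_real M" if "d \<le> c" "d \<le> S M" for d M
    using sub that by (simp add: le_hsubset_iff lower_reals_sel)
  have "c \<le> hlower_real ?U"
  proof (rule lower_realI)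
    show "d \<le> ?U p" if pq: "p < q" and "d \<le> c" and dU: "d \<le> ?U q" for p q d
      using dU
    proof (rule le_SUP_elim)
      fix M e assume "e \<le> d" "e \<le> S M \<sqinter> M q"
      then show "e \<le> ?U p" using pq \<open>d \<le> c\<close>
        by (intro SUP_upper2[of M]) (auto intro: lower_real_down[OF low])
    qed
    have "c \<le> (\<Squnion>M. S M)" using dir by (simp add: le_hdirected_iff)
    then show "c \<le> (\<Squnion>p. ?U p)"
    proof (rule le_SUP_elim)
      fix M d assume d: "d \<le> c" "d \<le> S M"
      show "d \<le> (\<Squnion>p. ?U p)"
        using lower_real_inhabited[OF low[OF d]]
      proof (rule le_SUP_elim)
        fix p e assume "e \<le> d" "e \<le> M p"
        then show "e \<le> (\<Squnion>p. ?U p)" using d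
          by (intro SUP_upper2[of p] SUP_upper2[of M]) auto
      qed
    qed
    show "d \<le> (\<Squnion>r. ?U r \<sqinter> tv (p < r))" if "d \<le> c" and dU: "d \<le> ?U p" for p d
      using dU
    proof (rule le_SUP_elim)
      fix M e assume e: "e \<le> d" "e \<le> S M \<sqinter> M p"
      then have "e \<le> (\<Squnion>r. M r \<sqinter> tv (p < r))"
        using \<open>d \<le> c\<close> by (intro lower_real_round low) auto
      then show "e \<le> (\<Squnion>r. ?U r \<sqinter> tv (p < r))"
      proof (rule le_SUP_elim)
        fix r f assume f: "f \<le> e" "f \<le> M r \<sqinter> tv (p < r)"
        then have "f \<le> ?U r" using e by (intro SUP_upper2[of M]) auto
        then show "f \<le> (\<Squnion>r. ?U r \<sqinter> tv (p < r))" using f by (intro SUP_upper2[of r]) auto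
      qed
    qed
  qed
  moreover have "d \<le> hle \<L> M ?U" if "d \<le> S M" for d M
    using that by (auto simp: le_hle_iff intro!: SUP_upper2[of M])
  moreover have "d \<le> hle \<L> ?U N" if le: "\<And>M e. e \<le> d \<Longrightarrow> e \<le> S M \<Longrightarrow> e \<le> hle \<L> M N" for d N
  proof -
    have "e \<le> N q" if "e \<le> d" and eU: "e \<le> ?U q" for e q
      using eU
    proof (rule le_SUP_elim)
      fix M f assume "f \<le> e" "f \<le> S M \<sqinter> M q"
      then show "f \<le> N q" using le[of f M] \<open>e \<le> d\<close> by (auto simp: le_hle_iff)
    qed
    then show ?thesis by (simp add: le_hle_iff)
  qed
  ultimately show ?thesis by (auto simp: le_his_sup_iff lower_reals_sel(1))
qed

lemma lower_reals_dcpo: "\<turnstile>\<^sub>H hdcpo \<L>"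
proof -
  have "d \<le> (\<Squnion>u. his_sup \<L> S u)"
    if "d \<le> hsubset \<L> S" "d \<le> hdirected (hle \<L>) S"
    for d :: "'h::complete_heyting_algebra" and S
    by (rule order_trans[OF lower_reals_union[OF that]]) (rule SUP_upper[OF UNIV_I])
  then show ?thesis
    using lower_reals_poset by (auto simp: valid_iff hdcpo_def le_INF_iff le_himp_iff)
qed

text \<open>The lower real of a rational.\<close>

abbreviation hrat :: "rat \<Rightarrow> rat \<Rightarrow> 'h::complete_heyting_algebra"
  where "hrat m \<equiv> (\<lambda>q. tv (q < m))"

lemma lower_real_hrat: "c \<le> hlower_real (hrat m)"
proof (rule lower_realI)
  show "c \<le> (\<Squnion>p. hrat m p)" by (rule SUP_upper2[of "m - 1"]) (auto simp: tv_def)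
  show "d \<le> (\<Squnion>r. hrat m r \<sqinter> tv (p < r))" if "d \<le> c" "d \<le> hrat m p" for p d
  proof (cases "p < m")
    case True
    then obtain r where "p < r" "r < m" using dense by blast
    then show ?thesis by (intro SUP_upper2[of r]) (auto simp: tv_def)
  qed (use that in \<open>auto simp: le_tv_iff\<close>)
qed (auto simp: le_tv_iff)

lemma hle_hrat:
  assumes "c \<le> hlower_real L" "c \<le> L m"
  shows "c \<le> hle \<L> (hrat m) L"
  unfolding le_hle_iff
proof (intro allI impI)
  fix q d assume "d \<le> c" "d \<le> hrat m q"
  then show "d \<le> L q"
    using assms lower_real_down[of d L q m] by (auto simp: le_tv_iff)
qed

lemma hle_trans: "c \<le> hle \<L> L M \<Longrightarrow> c \<le> hle \<L> M N \<Longrightarrow> c \<le> hle \<L> L N"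
  by (auto simp: le_hle_iff)

lemma le_hwaybelow_iff:
  "c \<le> hwaybelow D x y \<longleftrightarrow>
     (\<forall>S. \<forall>d\<le>c. d \<le> hsubset D S \<longrightarrow> d \<le> hdirected (hle D) S \<longrightarrow>
        (\<forall>e\<le>d. e \<le> (\<Squnion>u. his_sup D S u \<sqinter> hle D y u) \<longrightarrow> e \<le> (\<Squnion>s. S s \<sqinter> hle D x s)))"
  by (simp add: hwaybelow_def le_INF_iff le_himp_iff imp_conjL)

text \<open>The directed family of the rationals in \<open>y\<close>.\<close>

definition hrats :: "(rat \<Rightarrow> 'h) \<Rightarrow> (rat \<Rightarrow> 'h::complete_heyting_algebra) \<Rightarrow> 'h" where
  "hrats y M = hlower_real M \<sqinter> (\<Squnion>m. y m \<sqinter> heq \<L> M (hrat m))"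

lemma le_hrats: "c \<le> y m \<Longrightarrow> c \<le> hrats y (hrat m)"
  unfolding hrats_def using lower_real_hrat
  by (auto intro!: SUP_upper2[of m] simp: le_heq_iff)

lemma hrats_subset: "c \<le> hsubset \<L> (hrats y)"
  unfolding le_hsubset_iff
proof (intro conjI allI impI)
  fix M N d assume "d \<le> hrats y M" "d \<le> hmem \<L> N" "d \<le> heq \<L> M N"
  moreover have "d \<le> (\<Squnion>m. y m \<sqinter> heq \<L> N (hrat m))"
    if eq: "d \<le> heq \<L> M N" and sup: "d \<le> (\<Squnion>m. y m \<sqinter> heq \<L> M (hrat m))"
    using sup
  proof (rule le_SUP_elim)
    fix m e assume "e \<le> d" "e \<le> y m \<sqinter> heq \<L> M (hrat m)"
    then show "e \<le> (\<Squnion>m. y m \<sqinter> heq \<L> N (hrat m))" using eq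
      by (intro SUP_upper2[of m]) (auto simp: le_heq_iff)
  qed
  ultimately show "d \<le> hrats y N" by (simp add: hrats_def lower_reals_sel(1))
qed (simp add: hrats_def lower_reals_sel(1))

lemma hrats_elim:
  assumes "c \<le> hrats y M" and "\<And>m d. d \<le> c \<Longrightarrow> d \<le> y m \<Longrightarrow> d \<le> heq \<L> M (hrat m) \<Longrightarrow> d \<le> b"
  shows "c \<le> b"
proof -
  have "c \<le> (\<Squnion>m. y m \<sqinter> heq \<L> M (hrat m))" using assms(1) by (simp add: hrats_def)
  then show ?thesis by (rule le_SUP_elim) (use assms(2) in auto)
qed

lemma hrats_directed:
  assumes y: "c \<le> hlower_real y"
  shows "c \<le> hdirected (hle \<L>) (hrats y)"
  unfolding le_hdirected_iff
proof (intro conjI allI impI)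
  show "c \<le> (\<Squnion>M. hrats y M)"
    using lower_real_inhabited[OF y]
    by (rule le_SUP_elim) (rule SUP_upper2[OF UNIV_I], rule le_hrats)
  fix M N d assume "d \<le> c" and M: "d \<le> hrats y M" and N: "d \<le> hrats y N"
  show "d \<le> (\<Squnion>z. hrats y z \<sqinter> hle \<L> M z \<sqinter> hle \<L> N z)"
    using M
  proof (rule hrats_elim)
    fix m e assume e: "e \<le> d" "e \<le> y m" "e \<le> heq \<L> M (hrat m)"
    have "e \<le> hrats y N" using N e by auto
    then show "e \<le> (\<Squnion>z. hrats y z \<sqinter> hle \<L> M z \<sqinter> hle \<L> N z)"
    proof (rule hrats_elim)
      fix n f assume f: "f \<le> e" "f \<le> y n" "f \<le> heq \<L> N (hrat n)"
      have "f \<le> hrats y (hrat (max m n))"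
        using f e by (intro le_hrats) (auto simp: max_def)
      moreover have "f \<le> hle \<L> M (hrat (max m n))" "f \<le> hle \<L> N (hrat (max m n))"
        using f e by (auto simp: le_hle_iff le_heq_iff le_tv_iff less_max_iff_disj)
      ultimately show "f \<le> (\<Squnion>z. hrats y z \<sqinter> hle \<L> M z \<sqinter> hle \<L> N z)"
        by (intro SUP_upper2[of "hrat (max m n)"]) auto
    qed
  qed
qed

lemma hrats_sup:
  assumes y: "c \<le> hlower_real y"
  shows "c \<le> his_sup \<L> (hrats y) y"
  unfolding le_his_sup_iff
proof (intro conjI allI impI)
  show "d \<le> hle \<L> M y" if "d \<le> c" and M: "d \<le> hrats y M" for M d
    using M
  proof (rule hrats_elim)
    fix m e assume e: "e \<le> d" "e \<le> y m" "e \<le> heq \<L> M (hrat m)"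
    then have "e \<le> hle \<L> (hrat m) y" using that y by (intro hle_hrat) auto
    then show "e \<le> hle \<L> M y" using e by (auto simp: le_hle_iff le_heq_iff)
  qed
  show "d \<le> hle \<L> y v" if "d \<le> c" and le: "\<forall>M. \<forall>e\<le>d. e \<le> hrats y M \<longrightarrow> e \<le> hle \<L> M v" for v d
    unfolding le_hle_iff
  proof (intro allI impI)
    fix q e assume "e \<le> d" "e \<le> y q"
    then have "e \<le> (\<Squnion>r. y r \<sqinter> tv (q < r))" using that y by (intro lower_real_round) auto
    then show "e \<le> v q"
    proof (rule le_SUP_elim)
      fix r f assume f: "f \<le> e" "f \<le> y r \<sqinter> tv (q < r)"
      then have "f \<le> hle \<L> (hrat r) v" using le \<open>e \<le> d\<close> le_hrats[of f y r] by auto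
      then show "f \<le> v q" using f by (auto simp: le_hle_iff)
    qed
  qed
qed (use y in \<open>simp add: lower_reals_sel(1)\<close>)

lemma hwaybelow_lower_reals_iff:
  assumes y: "c \<le> hlower_real y"
  shows "c \<le> hwaybelow \<L> x y \<longleftrightarrow> c \<le> (\<Squnion>m. y m \<sqinter> hle \<L> x (hrat m))"
proof
  assume "c \<le> hwaybelow \<L> x y"
  moreover have "c \<le> (\<Squnion>u. his_sup \<L> (hrats y) u \<sqinter> hle \<L> y u)"
    using hrats_sup[OF y] by (intro SUP_upper2[of y]) (auto simp: le_hle_iff)
  ultimately have "c \<le> (\<Squnion>s. hrats y s \<sqinter> hle \<L> x s)"
    using hrats_subset[of c y] hrats_directed[OF y] unfolding le_hwaybelow_iff by blast
  then show "c \<le> (\<Squnion>m. y m \<sqinter> hle \<L> x (hrat m))"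
  proof (rule le_SUP_elim)
    fix s d assume d: "d \<le> c" "d \<le> hrats y s \<sqinter> hle \<L> x s"
    then have "d \<le> hrats y s" by simp
    then show "d \<le> (\<Squnion>m. y m \<sqinter> hle \<L> x (hrat m))"
    proof (rule hrats_elim)
      fix m e assume e: "e \<le> d" "e \<le> y m" "e \<le> heq \<L> s (hrat m)"
      moreover have "e \<le> hle \<L> x s" using d e by auto
      ultimately show "e \<le> (\<Squnion>m. y m \<sqinter> hle \<L> x (hrat m))"
        by (intro SUP_upper2[of m]) (auto simp: le_hle_iff le_heq_iff)
    qed
  qed
next
  assume m: "c \<le> (\<Squnion>m. y m \<sqinter> hle \<L> x (hrat m))"
  show "c \<le> hwaybelow \<L> x y"
    unfolding le_hwaybelow_iff
  proof (intro allI impI)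
    fix S d e
    assume "d \<le> c" and sub: "d \<le> hsubset \<L> S" and dir: "d \<le> hdirected (hle \<L>) S" and "e \<le> d"
      and sup: "e \<le> (\<Squnion>u. his_sup \<L> S u \<sqinter> hle \<L> y u)"
    let ?U = "\<lambda>q. \<Squnion>M. S M \<sqinter> M q" and ?G = "\<Squnion>s. S s \<sqinter> hle \<L> x s"
    have U: "e \<le> his_sup \<L> S ?U" using lower_reals_union[OF sub dir] \<open>e \<le> d\<close> by auto
    have yU: "e \<le> hle \<L> y ?U"
      using sup
    proof (rule le_SUP_elim)
      fix u f assume f: "f \<le> e" "f \<le> his_sup \<L> S u \<sqinter> hle \<L> y u"
      have "f \<le> his_sup \<L> S ?U" using U f by auto
      then have "f \<le> hle \<L> u ?U" using f unfolding le_inf_iff le_his_sup_iff by auto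
      with f show "f \<le> hle \<L> y ?U" by (auto intro: hle_trans)
    qed
    have "e \<le> (\<Squnion>m. y m \<sqinter> hle \<L> x (hrat m))" using m \<open>d \<le> c\<close> \<open>e \<le> d\<close> by auto
    then show "e \<le> ?G"
    proof (rule le_SUP_elim)
      fix m f assume f: "f \<le> e" "f \<le> y m \<sqinter> hle \<L> x (hrat m)"
      then have "f \<le> ?U m" using yU by (auto simp: le_hle_iff)
      then show "f \<le> ?G"
      proof (rule le_SUP_elim)
        fix M g assume g: "g \<le> f" "g \<le> S M \<sqinter> M m"
        have "g \<le> hlower_real M"
          using sub g f \<open>e \<le> d\<close> by (auto simp: le_hsubset_iff lower_reals_sel(1))
        then have "g \<le> hle \<L> (hrat m) M" using g by (intro hle_hrat) auto
        moreover have "g \<le> hle \<L> x (hrat m)" using f g by auto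
        ultimately show "g \<le> ?G" using g by (intro SUP_upper2[of M]) (auto intro: hle_trans)
      qed
    qed
  qed
qed

lemma hrat_waybelow:
  assumes "c \<le> hlower_real y" "c \<le> y m"
  shows "c \<le> hwaybelow \<L> (hrat m) y"
  unfolding hwaybelow_lower_reals_iff[OF assms(1)]
  using assms(2) by (intro SUP_upper2[of m]) (auto simp: le_hle_iff)

lemma lower_reals_continuous: "\<turnstile>\<^sub>H hcontinuous \<L>"
proof -
  have "c \<le> hdirected (hle \<L>) (\<lambda>y. hmem \<L> y \<sqinter> hwaybelow \<L> y x) \<sqinter>
            his_sup \<L> (\<lambda>y. hmem \<L> y \<sqinter> hwaybelow \<L> y x) x" (is "c \<le> hdirected _ ?W \<sqinter> _")
    if x: "c \<le> hlower_real x" for c :: "'h::complete_heyting_algebra" and x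
  proof -
    have W: "d \<le> ?W (hrat m)" if "d \<le> c" "d \<le> x m" for d m
      using that x by (auto simp: lower_reals_sel(1) lower_real_hrat intro!: hrat_waybelow)
    have we: "d \<le> b" if "d \<le> c" and d: "d \<le> ?W M"
      and *: "\<And>m e. e \<le> d \<Longrightarrow> e \<le> x m \<Longrightarrow> e \<le> hle \<L> M (hrat m) \<Longrightarrow> e \<le> b" for d M b
    proof -
      have "d \<le> (\<Squnion>m. x m \<sqinter> hle \<L> M (hrat m))"
        using d hwaybelow_lower_reals_iff[of d x M] x \<open>d \<le> c\<close> by auto
      then show ?thesis by (rule le_SUP_elim) (use * in auto)
    qed
    have "c \<le> hdirected (hle \<L>) ?W"
      unfolding le_hdirected_iff
    proof (intro conjI allI impI)
      show "c \<le> (\<Squnion>M. ?W M)"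
        using lower_real_inhabited[OF x]
        by (rule le_SUP_elim) (rule SUP_upper2[OF UNIV_I], rule W)
      fix M N d assume "d \<le> c" and M: "d \<le> ?W M" and N: "d \<le> ?W N"
      show "d \<le> (\<Squnion>z. ?W z \<sqinter> hle \<L> M z \<sqinter> hle \<L> N z)"
        using \<open>d \<le> c\<close> M
      proof (rule we)
        fix m e assume e: "e \<le> d" "e \<le> x m" "e \<le> hle \<L> M (hrat m)"
        have "e \<le> c" "e \<le> ?W N" using N e \<open>d \<le> c\<close> order_trans by blast+
        then show "e \<le> (\<Squnion>z. ?W z \<sqinter> hle \<L> M z \<sqinter> hle \<L> N z)"
        proof (rule we)
          fix n f assume f: "f \<le> e" "f \<le> x n" "f \<le> hle \<L> N (hrat n)"
          have "f \<le> ?W (hrat (max m n))"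
            using f e \<open>d \<le> c\<close> by (intro W) (auto simp: max_def)
          moreover have "f \<le> hle \<L> M (hrat m)" using f e by auto
          moreover have "f \<le> hle \<L> (hrat m) (hrat (max m n))" "f \<le> hle \<L> (hrat n) (hrat (max m n))"
            by (auto simp: le_hle_iff le_tv_iff)
          ultimately show "f \<le> (\<Squnion>z. ?W z \<sqinter> hle \<L> M z \<sqinter> hle \<L> N z)"
            using f by (intro SUP_upper2[of "hrat (max m n)"]) (auto intro: hle_trans)
        qed
      qed
    qed
    moreover have "c \<le> his_sup \<L> ?W x"
      unfolding le_his_sup_iff
    proof (intro conjI allI impI)
      show "d \<le> hle \<L> M x" if "d \<le> c" and M: "d \<le> ?W M" for M d
        using that
      proof (rule we)
        fix m e assume e: "e \<le> d" "e \<le> x m" "e \<le> hle \<L> M (hrat m)"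
        then have "e \<le> hle \<L> (hrat m) x" using that x by (intro hle_hrat) auto
        then show "e \<le> hle \<L> M x" using e by (auto intro: hle_trans)
      qed
      show "d \<le> hle \<L> x v" if "d \<le> c" and le: "\<forall>M. \<forall>e\<le>d. e \<le> ?W M \<longrightarrow> e \<le> hle \<L> M v" for v d
        unfolding le_hle_iff
      proof (intro allI impI)
        fix q e assume "e \<le> d" "e \<le> x q"
        then have "e \<le> (\<Squnion>r. x r \<sqinter> tv (q < r))" using that x by (intro lower_real_round) auto
        then show "e \<le> v q"
        proof (rule le_SUP_elim)
          fix r f assume f: "f \<le> e" "f \<le> x r \<sqinter> tv (q < r)"
          then have "f \<le> ?W (hrat r)" using \<open>e \<le> d\<close> \<open>d \<le> c\<close> by (intro W) auto
          then have "f \<le> hle \<L> (hrat r) v" using le \<open>e \<le> d\<close> f order_trans by blast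
          then show "f \<le> v q" using f by (auto simp: le_hle_iff)
        qed
      qed
    qed (use x in \<open>simp add: lower_reals_sel(1)\<close>)
    ultimately show ?thesis by simp
  qed
  then show ?thesis
    by (auto simp: valid_iff hcontinuous_def le_INF_iff le_himp_iff lower_reals_sel(1))
qed

subsection \<open>Locatedness of all lower reals implies excluded middle\<close>

lemma brouwerian_example:
  fixes a :: "'h::complete_heyting_algebra"
  defines "L \<equiv> (\<lambda>q::rat. if q < 0 then \<top> else if q < 1 then a else \<bottom>)"
  shows "\<turnstile>\<^sub>H hmem \<L> L" and "hlocated L (upper_cut L) \<le> a \<squnion> \<not>\<^sub>H a"
proof -
  have "c \<le> hlower_real L" for c
  proof (rule lower_realI)
    show "d \<le> L p" if "p < q" "d \<le> L q" for p q d
      using that by (auto simp: L_def bot_unique split: if_splits)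
    show "c \<le> (\<Squnion>p. L p)" by (rule SUP_upper2[of "-1"]) (auto simp: L_def)
    show "d \<le> (\<Squnion>r. L r \<sqinter> tv (p < r))" if "d \<le> c" "d \<le> L p" for p d
    proof -
      consider "p < 0" | "0 \<le> p" "p < 1" | "1 \<le> p" by linarith
      then show ?thesis
      proof cases
        case 1 then show ?thesis by (intro SUP_upper2[of "p / 2"]) (auto simp: L_def tv_def)
      next
        case 2 then show ?thesis using that
          by (intro SUP_upper2[of "(p + 1) / 2"]) (auto simp: L_def tv_def)
      next
        case 3 then show ?thesis using that by (auto simp: L_def bot_unique)
      qed
    qed
  qed
  then show "\<turnstile>\<^sub>H hmem \<L> L" by (simp add: valid_iff lower_reals_sel(1))
  have "c \<le> \<not>\<^sub>H a" if "c \<le> upper_cut L (1 / 2)" for c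
    using that unfolding upper_cut_def
  proof (rule le_SUP_elim)
    fix s d assume d: "d \<le> \<not>\<^sub>H L s \<sqinter> tv (s < 1 / 2)"
    show "d \<le> \<not>\<^sub>H a"
    proof (cases "s < 1 / 2")
      case True
      then have "a \<le> L s" by (simp add: L_def)
      then show ?thesis using d by (auto simp: le_hnot_iff)
    qed (use d in \<open>auto simp: le_tv_iff\<close>)
  qed
  then have "upper_cut L (1 / 2) \<le> \<not>\<^sub>H a" by blast
  moreover have "hlocated L (upper_cut L) \<le> (tv ((1 / 4::rat) < 1 / 2) \<rightarrow>\<^sub>H L (1 / 4) \<squnion> upper_cut L (1 / 2))"
    unfolding hlocated_def by (rule INF_lower2[OF UNIV_I], rule INF_lower2[OF UNIV_I order_refl])
  then have "hlocated L (upper_cut L) \<le> L (1 / 4) \<squnion> upper_cut L (1 / 2)"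
    by (simp add: himp_adjoint tv_def)
  moreover have "L (1 / 4) = a" by (simp add: L_def)
  ultimately show "hlocated L (upper_cut L) \<le> a \<squnion> \<not>\<^sub>H a"
    using sup_mono[of a a] by (metis order_refl order_trans)
qed

subsection \<open>The two-valued case\<close>

lemma bool_logic:
  "(a \<rightarrow>\<^sub>H b) = (a \<longrightarrow> b)" "(a \<leftrightarrow>\<^sub>H b) = (a \<longleftrightarrow> b)" "(\<not>\<^sub>H a) = (\<not> a)" "tv a = a" "(\<turnstile>\<^sub>H a) = a"
  by (auto simp: himp_def hiff_def hnot_def tv_def valid_def)

lemma hwaybelow_bool:
  "hwaybelow D x y \<longleftrightarrow>
     (\<forall>S. hsubset D S \<and> hdirected (hle D) S \<longrightarrow>
        (\<exists>u. his_sup D S u \<and> hle D y u) \<longrightarrow> (\<exists>s. S s \<and> hle D x s))"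
  by (simp add: hwaybelow_def bool_logic)

lemma hsharp_bool:
  "hsharp D x \<longleftrightarrow>
     (\<forall>y z. hmem D y \<and> hmem D z \<longrightarrow> hwaybelow D y z \<longrightarrow> hwaybelow D y x \<or> \<not> hle D z x)"
  by (simp add: hsharp_def bool_logic)

lemma hlower_real_bool:
  "hlower_real L \<longleftrightarrow>
     (\<forall>p q. p < q \<and> L q \<longrightarrow> L p) \<and> (\<exists>p. L p) \<and> (\<forall>p q. L p \<and> L q \<longrightarrow> (\<exists>r. L r \<and> p < r \<and> q < r))"
  by (simp add: hlower_real_def hdirected_def bool_logic)

lemma hlocated_bool:
  "hlocated L (upper_cut L) \<longleftrightarrow> (\<forall>p q. p < q \<longrightarrow> L p \<or> (\<exists>s. \<not> L s \<and> s < q))"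
  by (simp add: hlocated_def upper_cut_def bool_logic)

end

theory Submission
  imports Defs
begin

text \<open>
  Everything rests on the characterisation of \<open>y \<lless> z\<close> as: \<open>y \<sqsubseteq> hrat m\<close> for some \<open>m \<in> z\<close>.
  Sharpness applied to \<open>hrat r \<lless> hrat s\<close> with \<open>p < r < s < q\<close> gives \<open>p \<in> L\<close> or \<open>s \<notin> L\<close>. Conversely,
  if \<open>y \<sqsubseteq> hrat m\<close> with \<open>m \<in> z\<close>, roundedness gives \<open>r \<in> z\<close> with \<open>m < r\<close>, and locating \<open>L\<close> with
  respect to \<open>m < r\<close> gives \<open>y \<lless> L\<close> or a point below \<open>r\<close> outside \<open>L\<close>, which refutes \<open>z \<sqsubseteq> L\<close>.
\<close>

lemma le_hsharp_iff:
  "c \<le> hsharp D x \<longleftrightarrow>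
     (\<forall>y z. \<forall>d\<le>c. d \<le> hmem D y \<longrightarrow> d \<le> hmem D z \<longrightarrow> d \<le> hwaybelow D y z \<longrightarrow>
        d \<le> hwaybelow D y x \<squnion> \<not>\<^sub>H hle D z x)"
proof -
  \<comment> \<open>Merging the nested implications first lets \<open>le_himp_iff\<close> produce a
    single stage \<open>d\<close> for all premises, not a chain of shrinking stages.\<close>
  have curry: "c \<le> (a \<rightarrow>\<^sub>H b \<rightarrow>\<^sub>H e) \<longleftrightarrow> c \<le> (a \<sqinter> b \<rightarrow>\<^sub>H e)" for a b e
    by (simp add: himp_adjoint inf_assoc inf_left_commute)
  show ?thesis
    unfolding hsharp_def le_INF_iff curry unfolding le_himp_iff by (simp add: imp_conjL)
qed

text \<open>\<open>tv\<close> only takes the values \<top> and \<bottom>, so \<open>p < q\<close>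
  becomes an outer premise with no passage to a smaller stage.\<close>

lemma le_hlocated_iff: "c \<le> hlocated L U \<longleftrightarrow> (\<forall>p q. p < q \<longrightarrow> c \<le> L p \<squnion> U q)"
proof -
  have "c \<le> (tv P \<rightarrow>\<^sub>H b) \<longleftrightarrow> (P \<longrightarrow> c \<le> b)" for P b
    by (simp add: himp_adjoint tv_def)
  then show ?thesis by (simp add: hlocated_def le_INF_iff)
qed

lemma sharp_imp_located:
  assumes L: "c \<le> hlower_real L" and sharp: "c \<le> hsharp \<L> L"
  shows "c \<le> hlocated L (upper_cut L)"
  unfolding le_hlocated_iff
proof (intro allI impI)
  fix p q :: rat assume "p < q"
  \<comment> \<open>\<open>r < s\<close> gives the way-below pair, \<open>p < r\<close> turns
    \<open>hrat r\<close> \<sqsubseteq> \<open>hrat m\<close> into \<open>p < m\<close>, and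
    \<open>s < q\<close> makes \<open>s\<close> a witness for \<open>q\<close> in the upper
    cut.\<close>
  then obtain r where r: "p < r" "r < q" using dense by blast
  then obtain s where s: "r < s" "s < q" using dense by blast
  have "c \<le> hwaybelow \<L> (hrat r) (hrat s)"
    using s(1) by (intro hrat_waybelow lower_real_hrat) (simp add: tv_def)
  then have "c \<le> hwaybelow \<L> (hrat r) L \<squnion> \<not>\<^sub>H hle \<L> (hrat s) L"
    using sharp by (simp add: le_hsharp_iff lower_reals_sel(1) lower_real_hrat)
  then show "c \<le> L p \<squnion> upper_cut L q"
  proof (rule le_sup_elim)
    fix d assume d: "d \<le> c" "d \<le> hwaybelow \<L> (hrat r) L"
    then have "d \<le> hlower_real L" using L by auto
    with d have "d \<le> (\<Squnion>m. L m \<sqinter> hle \<L> (hrat r) (hrat m))"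
      by (simp add: hwaybelow_lower_reals_iff)
    then have "d \<le> L p"
    proof (rule le_SUP_elim)
      fix m e assume e: "e \<le> d" "e \<le> L m \<sqinter> hle \<L> (hrat r) (hrat m)"
      then have "e \<le> tv (p < m)" using r(1) by (auto simp: le_hle_iff tv_def)
      then show "e \<le> L p"
        using lower_real_down[of e L p m] L d e by (auto simp: le_tv_iff)
    qed
    then show "d \<le> L p \<squnion> upper_cut L q" by (rule le_supI1)
  next
    fix d assume d: "d \<le> c" "d \<le> \<not>\<^sub>H hle \<L> (hrat s) L"
    \<comment> \<open>Membership of \<open>s\<close> in \<open>L\<close> would put
      \<open>hrat s\<close> below \<open>L\<close>.\<close>
    have "d \<le> \<not>\<^sub>H L s"
      unfolding le_hnot_iff
    proof (intro allI impI)
      fix e assume e: "e \<le> d" "e \<le> L s"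
      then have "e \<le> hle \<L> (hrat s) L" using L d by (intro hle_hrat) auto
      then show "e = \<bottom>" using d(2) e(1) by (auto simp: le_hnot_iff)
    qed
    then have "d \<le> upper_cut L q"
      unfolding upper_cut_def using s(2) by (intro SUP_upper2[of s]) (auto simp: tv_def)
    then show "d \<le> L p \<squnion> upper_cut L q" by (rule le_supI2)
  qed
qed

lemma located_imp_sharp:
  assumes L: "c \<le> hlower_real L" and loc: "c \<le> hlocated L (upper_cut L)"
  shows "c \<le> hsharp \<L> L"
  unfolding le_hsharp_iff lower_reals_sel(1)
proof (intro allI impI)
  fix y z d
  assume d: "d \<le> c" and z: "d \<le> hlower_real z" and yz: "d \<le> hwaybelow \<L> y z"
  let ?G = "hwaybelow \<L> y L \<squnion> \<not>\<^sub>H hle \<L> z L"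
  have "d \<le> (\<Squnion>m. z m \<sqinter> hle \<L> y (hrat m))"
    using yz z by (simp add: hwaybelow_lower_reals_iff)
  then show "d \<le> ?G"
  proof (rule le_SUP_elim)
    fix m e assume e: "e \<le> d" "e \<le> z m \<sqinter> hle \<L> y (hrat m)"
    then have "e \<le> (\<Squnion>r. z r \<sqinter> tv (m < r))" using z by (intro lower_real_round) auto
    then show "e \<le> ?G"
    proof (rule le_SUP_elim)
      fix r f assume f: "f \<le> e" "f \<le> z r \<sqinter> tv (m < r)"
      show "f \<le> ?G"
      \<comment> \<open>Either \<open>m < r\<close> holds or \<open>f\<close> is \<bottom>, and then
        the goal is trivial.\<close>
      proof (cases "m < r")
        case True
        have fc: "f \<le> c" using d e f by auto
        moreover have "c \<le> L m \<squnion> upper_cut L r"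
          using loc True by (simp add: le_hlocated_iff)
        ultimately have "f \<le> L m \<squnion> upper_cut L r" by (rule order_trans)
        then show ?thesis
        proof (rule le_sup_elim)
          fix g assume g: "g \<le> f" "g \<le> L m"
          have "g \<le> hlower_real L" using L fc g by auto
          moreover have "g \<le> (\<Squnion>m. L m \<sqinter> hle \<L> y (hrat m))"
            using g f e by (intro SUP_upper2[of m]) auto
          ultimately have "g \<le> hwaybelow \<L> y L" by (simp add: hwaybelow_lower_reals_iff)
          then show "g \<le> ?G" by (rule le_supI1)
        next
          fix g assume g: "g \<le> f" "g \<le> upper_cut L r"
          have "g \<le> \<not>\<^sub>H hle \<L> z L"
            using g(2) unfolding upper_cut_def
          proof (rule le_SUP_elim)
            fix s h assume h: "h \<le> g" "h \<le> \<not>\<^sub>H L s \<sqinter> tv (s < r)"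
            show "h \<le> \<not>\<^sub>H hle \<L> z L"
              unfolding le_hnot_iff
            proof (intro allI impI)
              fix k assume k: "k \<le> h" "k \<le> hle \<L> z L"
              \<comment> \<open>\<open>z\<close> \<sqsubseteq> \<open>L\<close> moves
                \<open>r\<close> from \<open>z\<close> into \<open>L\<close>, and
                \<open>s < r\<close> then pulls \<open>s\<close> into \<open>L\<close>, against
                \<open>\<not>\<^sub>H L s\<close>.\<close>
              have "k \<le> z r" "k \<le> hlower_real L" "k \<le> tv (s < r)" "k \<le> \<not>\<^sub>H L s"
                using k h g f fc L by auto
              moreover from this k have "k \<le> L r" by (auto simp: le_hle_iff)
              ultimately show "k = \<bottom>"
                using lower_real_down[of k L s r] by (auto simp: le_tv_iff le_hnot_iff)
            qed
          qed
          then show "g \<le> ?G" by (rule le_supI2)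
        qed
      qed (use f in \<open>auto simp: le_tv_iff\<close>)
    qed
  qed
qed

theorem theorem7p22:
  fixes L :: "rat \<Rightarrow> 'h::complete_heyting_algebra"
  shows "\<turnstile>\<^sub>H hmem \<L> L \<rightarrow>\<^sub>H (hsharp \<L> L \<leftrightarrow>\<^sub>H hlocated L (upper_cut L))"
  unfolding valid_iff le_himp_iff le_hiff_iff lower_reals_sel(1)
proof (intro allI impI)
  fix c d e :: 'h
  assume "d \<le> hlower_real L" "e \<le> d"
  \<comment> \<open>The biconditional is tested at every smaller stage \<open>e\<close>, which is
    why both directions are proved at an arbitrary stage and not just at \<top>.\<close>
  then have "e \<le> hlower_real L" by (rule order_trans[rotated])
  then show "e \<le> hsharp \<L> L \<longleftrightarrow> e \<le> hlocated L (upper_cut L)"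
    by (blast intro: sharp_imp_located located_imp_sharp)
qed

end
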